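(* Let $n\ge 2$, $\nu\in(0,1]$, $\beta_1,\dots,\beta_n>0$ and $\bar\beta=\sum_{i=1}^n\beta_i$. Let $Z_1,\dots,Z_n$ be independent random variables with $Z_i\sim FG(1,\beta_i,\nu)$ for $i=1,\dots,n$. Put $W=Z_1+\dots+Z_n$ and $Q_i=Z_i/W$, $i=1,\dots,n$. Then the random vector $\bm{Q}=(Q_1,\dots,Q_{n-1})$ has joint probability density function, for $q_1,\dots,q_{n-1}\in(0,1)$ with $q_1+\dots+q_{n-1}<1$, \begin{align*} f_{\bm{Q}}(q_1,\dots,q_{n-1}) = {}& \left( \prod_{i=1}^{n-1} q_i^{\nu \beta_i-1} \right)\left( 1-\sum_{i=1}^{n-1} q_i\right)^{\nu \beta_n-1} \\ &\times \int_0^\infty y^{\nu \bar{\beta} -1} \left(\prod_{i=1}^{n-1} E_{\nu,\nu \beta_i}^{\beta_i}\bigl(-(yq_i)^\nu\bigr)\right) E_{\nu,\nu \beta_n}^{\beta_n} \biggl( -\Bigl( y-y\sum_{i=1}^{n-1}q_i \Bigr)^\nu \biggr)\, \mathrm dy . \end{align*}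
   Context: The three-parameter Mittag-Leffler function is $E_{\alpha,\beta}^\delta(z) = \sum_{r=0}^\infty \frac{z^r}{\Gamma(\alpha r + \beta)}\frac{\Gamma(\delta+r)}{r!\,\Gamma(\delta)}$. For $\lambda>0$, $\beta>0$, $\nu\in(0,1]$, a positive random variable $X$ is fractional Gamma distributed, written $X\sim FG(\lambda,\beta,\nu)$, if it has probability density function $\lambda^\beta x^{\nu\beta-1}E_{\nu,\nu\beta}^{\beta}(-\lambda x^\nu)$, $x>0$; its Laplace transform is $\mathbb{E}e^{-zX}=\left(\frac{\lambda}{\lambda+z^\nu}\right)^\beta$, $z>0$. *)

theory Defs
  imports "HOL-Probability.Probability"
begin

definition mittag_leffler3 :: "'a::Gamma \<Rightarrow> 'a \<Rightarrow> 'a \<Rightarrow> 'a \<Rightarrow> 'a" where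
  "mittag_leffler3 \<alpha> \<beta> \<delta> z =
     (\<Sum>r. z ^ r / Gamma (\<alpha> * of_nat r + \<beta>) * (Gamma (\<delta> + of_nat r) / (fact r * Gamma \<delta>)))"

text \<open>
  \<^const>\<open>distributed\<close> takes densities with values in \<^typ>\<open>ennreal\<close>, and \<^const>\<open>ennreal\<close> maps
  negative reals to 0. A real-valued density is therefore required to be nonnegative explicitly.
\<close>

definition has_real_density ::
    "'w measure \<Rightarrow> 'b measure \<Rightarrow> ('w \<Rightarrow> 'b) \<Rightarrow> ('b \<Rightarrow> real) \<Rightarrow> bool" where
  "has_real_density M N X f \<longleftrightarrow>
     (\<forall>x\<in>space N. 0 \<le> f x) \<and> distributed M N X (\<lambda>x. ennreal (f x))"

definition frac_gamma_density :: "real \<Rightarrow> real \<Rightarrow> real \<Rightarrow> real \<Rightarrow> real" where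
  "frac_gamma_density l \<beta> \<nu> x =
     (if x > 0
      then l powr \<beta> * x powr (\<nu> * \<beta> - 1) * mittag_leffler3 \<nu> (\<nu> * \<beta>) \<beta> (- l * x powr \<nu>)
      else 0)"

text \<open>The density vanishes off \<open>x > 0\<close>, so such a variable is positive almost surely.\<close>

definition frac_gamma_distributed ::
    "'w measure \<Rightarrow> ('w \<Rightarrow> real) \<Rightarrow> real \<Rightarrow> real \<Rightarrow> real \<Rightarrow> bool" where
  "frac_gamma_distributed M X l \<beta> \<nu> \<longleftrightarrow>
     has_real_density M lborel X (frac_gamma_density l \<beta> \<nu>)"

end

theory Submission
  imports Defs
begin

text \<open>
  Nothing specific to the Mittag-Leffler function enters: for independent \<open>Z\<^sub>i\<close> with densities \<open>f\<^sub>i\<close> on the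
  positive half-line, substituting \<open>z\<^sub>n = y - (z\<^sub>1 + \<dots> + z\<^sub>n\<^sub>-\<^sub>1)\<close> and then \<open>z\<^sub>i = y q\<^sub>i\<close> for \<open>i < n\<close> in the
  joint density gives the density
  \<open>\<integral> y\<^sup>n\<^sup>-\<^sup>1 f\<^sub>1(y q\<^sub>1) \<dots> f\<^sub>n\<^sub>-\<^sub>1(y q\<^sub>n\<^sub>-\<^sub>1) f\<^sub>n(y (1 - q\<^sub>1 - \<dots> - q\<^sub>n\<^sub>-\<^sub>1)) dy\<close> of the ratios. The two
  substitutions are a translation and a scaling, so no Jacobian determinant is needed.
\<close>

text \<open>A product of sigma-finite measures is determined by its values on boxes. On a box the
  integrand splits into factors of one coordinate each, and Tonelli turns the integral into the
  product of the marginal masses.\<close>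

lemma density_PiM:
  assumes I: "finite I" and M: "\<And>i. sigma_finite_measure (M i)"
    and f: "\<And>i. i \<in> I \<Longrightarrow> f i \<in> borel_measurable (M i)"
    and fin: "\<And>i. i \<in> I \<Longrightarrow> sigma_finite_measure (density (M i) (f i))"
  shows "PiM I (\<lambda>i. density (M i) (f i)) = density (PiM I M) (\<lambda>x. \<Prod>i\<in>I. f i (x i))"
proof -
  \<comment> \<open>\<open>fin\<close> speaks only of indices in \<open>I\<close>, whereas
    \<open>product_sigma_finite\<close> asks for sigma-finiteness at every index. Outside
    \<open>I\<close>, \<open>D\<close> therefore falls back on \<open>M\<close>.\<close>
  define D where "D i = (if i \<in> I then density (M i) (f i) else M i)" for i
  interpret M: product_sigma_finite M using M by (rule product_sigma_finite.intro)
  interpret D: product_sigma_finite D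
    using M fin by (intro product_sigma_finite.intro) (auto simp: D_def)
  have [measurable]: "(\<lambda>x. f i (x i)) \<in> borel_measurable (PiM I M)" if "i \<in> I" for i
    using measurable_compose[OF measurable_component_singleton[OF that, of M] f[OF that]] .
  have "density (PiM I M) (\<lambda>x. \<Prod>i\<in>I. f i (x i)) = PiM I D"
  proof (rule D.PiM_eqI[OF I])
    show "sets (density (PiM I M) (\<lambda>x. \<Prod>i\<in>I. f i (x i))) = sets (PiM I D)"
      by (simp, intro sets_PiM_cong) (auto simp: D_def)
  next
    fix A assume "\<And>i. i \<in> I \<Longrightarrow> A i \<in> sets (D i)"
    then have A: "A i \<in> sets (M i)" if "i \<in> I" for i
      using that by (force simp: D_def)
    have "emeasure (density (PiM I M) (\<lambda>x. \<Prod>i\<in>I. f i (x i))) (Pi\<^sub>E I A)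
      = (\<integral>\<^sup>+x. (\<Prod>i\<in>I. f i (x i)) * indicator (Pi\<^sub>E I A) x \<partial>PiM I M)"
      using A I by (intro emeasure_density sets_PiM_I_finite borel_measurable_prod) auto
    also have "\<dots> = (\<integral>\<^sup>+x. (\<Prod>i\<in>I. f i (x i) * indicator (A i) (x i)) \<partial>PiM I M)"
    proof (rule nn_integral_cong)
      fix x assume "x \<in> space (PiM I M)"
      then have "indicator (Pi\<^sub>E I A) x = (\<Prod>i\<in>I. indicator (A i) (x i) :: ennreal)"
        using I by (auto simp: indicator_def space_PiM PiE_iff prod_zero_iff)
      then show "(\<Prod>i\<in>I. f i (x i)) * indicator (Pi\<^sub>E I A) x
          = (\<Prod>i\<in>I. f i (x i) * indicator (A i) (x i))"
        by (simp add: prod.distrib)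
    qed
    also have "\<dots> = (\<Prod>i\<in>I. \<integral>\<^sup>+x. f i x * indicator (A i) x \<partial>M i)"
      using A f by (intro M.product_nn_integral_prod I) auto
    also have "\<dots> = (\<Prod>i\<in>I. emeasure (D i) (A i))"
      using A f by (intro prod.cong) (auto simp: D_def emeasure_density)
    finally show "emeasure (density (PiM I M) (\<lambda>x. \<Prod>i\<in>I. f i (x i))) (Pi\<^sub>E I A)
      = (\<Prod>i\<in>I. emeasure (D i) (A i))" .
  qed
  also have "PiM I D = PiM I (\<lambda>i. density (M i) (f i))"
    by (intro PiM_cong) (auto simp: D_def)
  finally show ?thesis ..
qed

text \<open>Independence makes the law of the vector the product of the marginal laws, and
  \<open>density_PiM\<close> merges their densities.\<close>

lemma (in prob_space) indep_vars_distributed_PiM: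
  fixes X :: "'i \<Rightarrow> 'a \<Rightarrow> real"
  assumes I: "finite I" "I \<noteq> {}" and indep: "indep_vars (\<lambda>_. borel) X I"
    and D: "\<And>i. i \<in> I \<Longrightarrow> distributed M lborel (X i) (f i)"
  shows "distributed M (PiM I (\<lambda>_. lborel)) (\<lambda>\<omega>. \<lambda>i\<in>I. X i \<omega>) (\<lambda>x. \<Prod>i\<in>I. f i (x i))"
proof -
  have X [measurable]: "X i \<in> borel_measurable M" and f [measurable]: "f i \<in> borel_measurable borel"
    and eq: "distr M borel (X i) = density lborel (f i)" if "i \<in> I" for i
    using D[OF that] by (auto simp: distributed_def cong: distr_cong)
  \<comment> \<open>\<open>density lborel (f i)\<close> is the law of \<open>X i\<close>, hence a
    probability measure.\<close>
  have sf: "sigma_finite_measure (density lborel (f i))" if "i \<in> I" for i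
    using prob_space_distr[OF X[OF that]] eq[OF that]
    by (simp add: prob_space_imp_sigma_finite)
  have S: "sets (PiM I (\<lambda>_. lborel :: real measure)) = sets (PiM I (\<lambda>_. borel))"
    by (intro sets_PiM_cong) auto
  have "distr M (PiM I (\<lambda>_. lborel)) (\<lambda>\<omega>. \<lambda>i\<in>I. X i \<omega>)
      = distr M (PiM I (\<lambda>_. borel)) (\<lambda>\<omega>. \<lambda>i\<in>I. X i \<omega>)"
    using S by (intro distr_cong) auto
  also have "\<dots> = PiM I (\<lambda>i. distr M borel (X i))"
    using indep_vars_iff_distr_eq_PiM'[where M' = "\<lambda>_. borel" and X = X, OF I(2)] indep X by simp
  also have "\<dots> = PiM I (\<lambda>i. density lborel (f i))"
    using eq by (intro PiM_cong) auto
  also have "\<dots> = density (PiM I (\<lambda>_. lborel)) (\<lambda>x. \<Prod>i\<in>I. f i (x i))"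
    using I sf by (intro density_PiM) (auto simp: lborel.sigma_finite_measure_axioms)
  finally show ?thesis
    by (auto simp: distributed_def intro!: borel_measurable_prod_ennreal measurable_restrict)
qed

text \<open>By induction on \<open>I\<close>, each coordinate contributes one factor |c| through the
  one-dimensional linear substitution.\<close>

lemma nn_integral_PiM_lborel_scale:
  fixes c :: real
  assumes "finite I" and c: "c \<noteq> 0" and "h \<in> borel_measurable (PiM I (\<lambda>_. lborel))"
  shows "(\<integral>\<^sup>+x. h x \<partial>PiM I (\<lambda>_. lborel))
    = ennreal \<bar>c\<bar> ^ card I * (\<integral>\<^sup>+x. h (\<lambda>i\<in>I. c * x i) \<partial>PiM I (\<lambda>_. lborel))"
  using assms(1,3)
proof (induction I arbitrary: h rule: finite_induct)
  case empty
  then show ?case by (simp add: PiM_empty nn_integral_count_space_finite)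
next
  case (insert k I)
  interpret product_sigma_finite "\<lambda>_::'a. lborel :: real measure" ..
  note [measurable] = insert.prems
  have I [simp]: "finite I" "k \<notin> I" by fact+
  interpret I: sigma_finite_measure "PiM I (\<lambda>_. lborel :: real measure)"
    by (rule sigma_finite) simp
  have [measurable]: "(\<lambda>p. (snd p)(k := fst p))
      \<in> borel \<Otimes>\<^sub>M PiM I (\<lambda>_. lborel :: real measure) \<rightarrow>\<^sub>M PiM (insert k I) (\<lambda>_. lborel)"
    by (rule measurable_fun_upd[where J = I]) auto
  have upd: "(\<lambda>y. \<integral>\<^sup>+x. g (x(k := y)) \<partial>PiM I (\<lambda>_. lborel)) \<in> borel_measurable borel"
    if [measurable]: "g \<in> borel_measurable (PiM (insert k I) (\<lambda>_. lborel))"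
    for g :: "('a \<Rightarrow> real) \<Rightarrow> ennreal"
    by (rule I.borel_measurable_nn_integral) (simp add: case_prod_beta')
  \<comment> \<open>The new coordinate is placed in the outer integral: there the one-dimensional
    substitution applies to it, and the induction hypothesis then treats the inner integral for each
    fixed \<open>y\<close>.\<close>
  have "(\<integral>\<^sup>+x. h x \<partial>PiM (insert k I) (\<lambda>_. lborel))
      = (\<integral>\<^sup>+y. \<integral>\<^sup>+x. h (x(k := y)) \<partial>PiM I (\<lambda>_. lborel) \<partial>lborel)"
    by (simp add: product_nn_integral_insert_rev)
  also have "\<dots> = ennreal \<bar>c\<bar> * (\<integral>\<^sup>+y. \<integral>\<^sup>+x. h (x(k := c * y)) \<partial>PiM I (\<lambda>_. lborel) \<partial>lborel)"
    by (subst nn_integral_real_affine[where t = 0, OF _ c]) (auto intro: upd)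
  also have "\<dots> = ennreal \<bar>c\<bar> * (\<integral>\<^sup>+y. ennreal \<bar>c\<bar> ^ card I
      * (\<integral>\<^sup>+x. h (\<lambda>i\<in>insert k I. c * (x(k := y)) i) \<partial>PiM I (\<lambda>_. lborel)) \<partial>lborel)"
  proof (intro arg_cong[where f = "(*) _"] nn_integral_cong)
    fix y :: real
    have meas: "(\<lambda>x. h (x(k := c * y))) \<in> borel_measurable (PiM I (\<lambda>_. lborel))"
      by (rule measurable_compose[OF measurable_fun_upd[where J = I] insert.prems]) auto
    have eq: "(\<lambda>i\<in>insert k I. c * (x(k := y)) i) = (\<lambda>i\<in>I. c * x i)(k := c * y)" for x
      by auto
    show "(\<integral>\<^sup>+x. h (x(k := c * y)) \<partial>PiM I (\<lambda>_. lborel)) = ennreal \<bar>c\<bar> ^ card I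
        * (\<integral>\<^sup>+x. h (\<lambda>i\<in>insert k I. c * (x(k := y)) i) \<partial>PiM I (\<lambda>_. lborel))"
      unfolding eq by (rule insert.IH[OF meas])
  qed
  also have "\<dots> = ennreal \<bar>c\<bar> ^ card (insert k I)
      * (\<integral>\<^sup>+y. \<integral>\<^sup>+x. h (\<lambda>i\<in>insert k I. c * (x(k := y)) i) \<partial>PiM I (\<lambda>_. lborel) \<partial>lborel)"
    using insert.hyps upd[of "\<lambda>z. h (\<lambda>i\<in>insert k I. c * z i)"]
    by (simp add: nn_integral_cmult mult.assoc del: fun_upd_apply)
  also have "(\<integral>\<^sup>+y. \<integral>\<^sup>+x. h (\<lambda>i\<in>insert k I. c * (x(k := y)) i) \<partial>PiM I (\<lambda>_. lborel) \<partial>lborel)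
      = (\<integral>\<^sup>+x. h (\<lambda>i\<in>insert k I. c * x i) \<partial>PiM (insert k I) (\<lambda>_. lborel))"
    by (subst product_nn_integral_insert_rev) auto
  finally show ?case .
qed

text \<open>Index \<open>k\<close> is the coordinate traded for the total \<open>y\<close>, and
  \<open>y ^ card I\<close> is the volume factor of scaling the remaining ones. The hypothesis
  \<open>zero\<close> confines the joint density to a positive total, where passing from coordinates
  to ratios is invertible.\<close>

lemma (in prob_space) distributed_ratios_of_sum:
  fixes Z :: "'i \<Rightarrow> 'a \<Rightarrow> real" and f :: "'i \<Rightarrow> real \<Rightarrow> ennreal"
  assumes I: "finite I" "k \<notin> I"
    and indep: "indep_vars (\<lambda>_. borel) Z (insert k I)"
    and D: "\<And>i. i \<in> insert k I \<Longrightarrow> distributed M lborel (Z i) (f i)"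
    and zero: "\<And>i x. i \<in> insert k I \<Longrightarrow> x \<le> 0 \<Longrightarrow> f i x = 0"
  shows "distributed M (PiM I (\<lambda>_. lborel)) (\<lambda>\<omega>. \<lambda>i\<in>I. Z i \<omega> / (\<Sum>j\<in>insert k I. Z j \<omega>))
    (\<lambda>q. \<integral>\<^sup>+y. indicator {0<..} y * ennreal y ^ card I
      * ((\<Prod>i\<in>I. f i (y * q i)) * f k (y * (1 - (\<Sum>i\<in>I. q i)))) \<partial>lborel)"
proof -
  define L :: "('i \<Rightarrow> real) measure" where "L = PiM I (\<lambda>_. lborel)"
  define J :: "('i \<Rightarrow> real) measure" where "J = PiM (insert k I) (\<lambda>_. lborel)"
  define R :: "('i \<Rightarrow> real) \<Rightarrow> 'i \<Rightarrow> real"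
    where "R z = (\<lambda>i\<in>I. z i / (\<Sum>j\<in>insert k I. z j))" for z
  define V where "V \<omega> = (\<lambda>i\<in>insert k I. Z i \<omega>)" for \<omega>
  define g where "g q y = indicator {0<..} y * ennreal y ^ card I
      * ((\<Prod>i\<in>I. f i (y * q i)) * f k (y * (1 - (\<Sum>i\<in>I. q i))))" for q y
  interpret product_sigma_finite "\<lambda>_::'i. lborel :: real measure" ..
  interpret L: sigma_finite_measure L
    unfolding L_def by (rule sigma_finite) fact
  interpret P: pair_sigma_finite L "lborel :: real measure" ..
  have f [measurable]: "f i \<in> borel_measurable borel" if "i \<in> insert k I" for i
    using D[OF that] by (simp add: distributed_def)
  have fk [measurable]: "f k \<in> borel_measurable borel" by (rule f) simp
  have comp [measurable]: "(\<lambda>x. x i) \<in> borel_measurable L" if "i \<in> I" for i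
    using measurable_component_singleton[OF that, of "\<lambda>_. lborel"] by (simp add: L_def)
  have compJ [measurable]: "(\<lambda>x. x i) \<in> borel_measurable J" if "i \<in> insert k I" for i
    using measurable_component_singleton[OF that, of "\<lambda>_. lborel"] by (simp add: J_def)
  have into_L: "(\<lambda>x. \<lambda>i\<in>I. h i x) \<in> N \<rightarrow>\<^sub>M L"
    if "\<And>i. i \<in> I \<Longrightarrow> h i \<in> borel_measurable N" for h and N :: "'c measure"
    unfolding L_def using that by (intro measurable_restrict) simp
  have R: "R \<in> J \<rightarrow>\<^sub>M L"
    unfolding R_def by (rule into_L) (use I in measurable)
  have V: "distributed M J V (\<lambda>x. \<Prod>i\<in>insert k I. f i (x i))"
    unfolding J_def V_def using I indep D by (intro indep_vars_distributed_PiM) auto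
  note V_meas = distributed_measurable[OF V]
  have g_meas: "(\<lambda>(q, y). g q y) \<in> borel_measurable (L \<Otimes>\<^sub>M lborel)"
    unfolding g_def by measurable
  have int_meas: "(\<lambda>q. \<integral>\<^sup>+y. g q y \<partial>lborel) \<in> borel_measurable L"
    by (rule lborel.borel_measurable_nn_integral[OF g_meas])
  have RV: "R (V \<omega>) = (\<lambda>i\<in>I. Z i \<omega> / (\<Sum>j\<in>insert k I. Z j \<omega>))" for \<omega>
    using I by (auto simp: R_def V_def fun_eq_iff intro!: sum.cong)

  have "distr M L (\<lambda>\<omega>. R (V \<omega>)) = density L (\<lambda>q. \<integral>\<^sup>+y. g q y \<partial>lborel)"
  proof (rule measure_eqI)
    fix A assume "A \<in> sets (distr M L (\<lambda>\<omega>. R (V \<omega>)))"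
    then have A [measurable]: "A \<in> sets L" by simp
    \<comment> \<open>The joint density times the event, written in the coordinates \<open>x\<close>
      on \<open>I\<close> and the total \<open>w\<close>; the coordinate at \<open>k\<close> has
      become \<open>w\<close> minus the sum of \<open>x\<close>.\<close>
    define h where "h x w = (\<Prod>i\<in>I. f i (x i)) * f k (w - (\<Sum>i\<in>I. x i))
      * indicator A (\<lambda>i\<in>I. x i / w)" for x w
    have h_meas [measurable]: "(\<lambda>(x, w). h x w) \<in> borel_measurable (L \<Otimes>\<^sub>M lborel)"
      unfolding h_def case_prod_beta'
      by (intro borel_measurable_times_ennreal measurable_compose[OF into_L borel_measurable_indicator[OF A]])
        measurable
    have "emeasure (distr M L (\<lambda>\<omega>. R (V \<omega>))) A = emeasure (distr (distr M J V) L R) A"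
      using distr_distr[OF R V_meas] by (simp add: comp_def)
    also have "\<dots> = (\<integral>\<^sup>+z. indicator A (R z) \<partial>distr M J V)"
      using R A nn_integral_distr[of R "distr M J V" L "indicator A"] by simp
    also have "\<dots> = (\<integral>\<^sup>+z. (\<Prod>i\<in>insert k I. f i (z i)) * indicator A (R z) \<partial>J)"
      unfolding distributed_distr_eq_density[OF V] using R A distributed_borel_measurable[OF V]
      by (intro nn_integral_density) auto
    also have "\<dots> = (\<integral>\<^sup>+x. \<integral>\<^sup>+t. (\<Prod>i\<in>insert k I. f i ((x(k := t)) i))
        * indicator A (R (x(k := t))) \<partial>lborel \<partial>L)"
      unfolding J_def L_def using I R A distributed_borel_measurable[OF V]
      by (intro product_nn_integral_insert) (auto simp: J_def)
    also have "\<dots> = (\<integral>\<^sup>+x. \<integral>\<^sup>+t. h x (t + (\<Sum>i\<in>I. x i)) \<partial>lborel \<partial>L)"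
    proof (intro nn_integral_cong)
      fix x and t :: real
      have "(\<Prod>i\<in>insert k I. f i ((x(k := t)) i)) = (\<Prod>i\<in>I. f i (x i)) * f k t"
        using I by (auto simp: mult.commute intro!: prod.cong arg_cong2[where f = "(*)"])
      moreover have "(\<Sum>j\<in>I. (x(k := t)) j) = (\<Sum>i\<in>I. x i)"
        using I by (intro sum.cong) auto
      then have "R (x(k := t)) = (\<lambda>i\<in>I. x i / (t + (\<Sum>i\<in>I. x i)))"
        using I by (auto simp: R_def fun_eq_iff)
      ultimately show "(\<Prod>i\<in>insert k I. f i ((x(k := t)) i)) * indicator A (R (x(k := t)))
          = h x (t + (\<Sum>i\<in>I. x i))"
        by (simp add: h_def)
    qed
    \<comment> \<open>For fixed \<open>x\<close>, the passage from the last coordinate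
      \<open>t\<close> to the total is a translation, which preserves Lebesgue measure.\<close>
    also have "\<dots> = (\<integral>\<^sup>+x. \<integral>\<^sup>+w. h x w \<partial>lborel \<partial>L)"
    proof (rule nn_integral_cong)
      fix x assume "x \<in> space L"
      then have "h x \<in> borel_measurable borel"
        using measurable_Pair2[OF h_meas, of x] by simp
      from nn_integral_real_affine[OF this, of 1 "\<Sum>i\<in>I. x i"]
      show "(\<integral>\<^sup>+t. h x (t + (\<Sum>i\<in>I. x i)) \<partial>lborel) = (\<integral>\<^sup>+w. h x w \<partial>lborel)"
        by (simp add: add.commute)
    qed
    \<comment> \<open>The order is exchanged so that the total is a constant while the other
      coordinates are rescaled by it.\<close>
    also have "\<dots> = (\<integral>\<^sup>+w. \<integral>\<^sup>+x. h x w \<partial>L \<partial>lborel)"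
      by (rule P.Fubini'[symmetric, OF h_meas])
    also have "\<dots> = (\<integral>\<^sup>+w. \<integral>\<^sup>+q. g q w * indicator A q \<partial>L \<partial>lborel)"
    proof (rule nn_integral_cong)
      fix w :: real
      show "(\<integral>\<^sup>+x. h x w \<partial>L) = (\<integral>\<^sup>+q. g q w * indicator A q \<partial>L)"
      proof (cases "w > 0")
        case False
        \<comment> \<open>Coordinates with a nonpositive total cannot all be positive, so some
          factor of the joint density vanishes.\<close>
        have "h x w = 0" for x
        proof (cases "\<exists>i\<in>I. x i \<le> 0")
          case True
          then show ?thesis using I zero by (auto simp: h_def prod_zero_iff)
        next
          case neg: False
          then have "w - (\<Sum>i\<in>I. x i) \<le> 0"
            using False sum_nonneg[of I x] by force
          then show ?thesis using zero by (simp add: h_def)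
        qed
        then show ?thesis using False by (simp add: g_def)
      next
        case True
        have hw: "(\<lambda>x. h x w) \<in> borel_measurable L"
          using measurable_Pair1[OF h_meas, of w] by simp
        have "(\<integral>\<^sup>+x. h x w \<partial>L) = ennreal w ^ card I * (\<integral>\<^sup>+q. h (\<lambda>i\<in>I. w * q i) w \<partial>L)"
          using nn_integral_PiM_lborel_scale[OF I(1), of w "\<lambda>x. h x w"] hw True
          by (simp add: L_def)
        also have "\<dots> = (\<integral>\<^sup>+q. ennreal w ^ card I * h (\<lambda>i\<in>I. w * q i) w \<partial>L)"
          by (rule nn_integral_cmult[symmetric], rule measurable_compose[OF into_L hw]) measurable
        also have "\<dots> = (\<integral>\<^sup>+q. g q w * indicator A q \<partial>L)"
        proof (rule nn_integral_cong)
          \<comment> \<open>Points of \<open>L\<close> are extensional, so multiplying by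
            \<open>w\<close> and dividing again returns \<open>q\<close> itself, also outside
            \<open>I\<close>.\<close>
          fix q assume "q \<in> space L"
          then have "(\<lambda>i\<in>I. (\<lambda>i\<in>I. w * q i) i / w) = q"
            using True by (auto simp: L_def space_PiM PiE_def extensional_def fun_eq_iff)
          moreover have "w - (\<Sum>i\<in>I. (\<lambda>i\<in>I. w * q i) i) = w * (1 - (\<Sum>i\<in>I. q i))"
            by (simp add: right_diff_distrib sum_distrib_left cong: sum.cong)
          moreover have "(\<Prod>i\<in>I. f i ((\<lambda>i\<in>I. w * q i) i)) = (\<Prod>i\<in>I. f i (w * q i))"
            by (intro prod.cong) auto
          ultimately show "ennreal w ^ card I * h (\<lambda>i\<in>I. w * q i) w = g q w * indicator A q"
            using True by (simp only: h_def g_def) (simp add: mult.assoc)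
        qed
        finally show ?thesis .
      qed
    qed
    also have "\<dots> = (\<integral>\<^sup>+q. \<integral>\<^sup>+y. g q y * indicator A q \<partial>lborel \<partial>L)"
      using borel_measurable_times_ennreal[OF g_meas measurable_compose[OF measurable_fst
          borel_measurable_indicator[OF A]]]
      by (intro P.Fubini') (simp add: case_prod_beta')
    also have "\<dots> = (\<integral>\<^sup>+q. (\<integral>\<^sup>+y. g q y \<partial>lborel) * indicator A q \<partial>L)"
      using measurable_Pair2[OF g_meas] by (intro nn_integral_cong nn_integral_multc) simp
    also have "\<dots> = emeasure (density L (\<lambda>q. \<integral>\<^sup>+y. g q y \<partial>lborel)) A"
      by (rule emeasure_density[OF int_meas A, symmetric])
    finally show "emeasure (distr M L (\<lambda>\<omega>. R (V \<omega>))) A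
      = emeasure (density L (\<lambda>q. \<integral>\<^sup>+y. g q y \<partial>lborel)) A" .
  qed simp
  moreover note int_meas
  moreover have "(\<lambda>\<omega>. R (V \<omega>)) \<in> M \<rightarrow>\<^sub>M L"
    by (rule measurable_compose[OF V_meas R])
  ultimately show ?thesis
    unfolding distributed_def RV g_def L_def by blast
qed

text \<open>
  A divergent Bochner integral is 0, so the real-valued density may differ from the \<^typ>\<open>ennreal\<close>-valued
  one, but only on a null set, because the latter has total mass 1.
\<close>

lemma (in prob_space) has_real_density_lebesgue_integral:
  assumes D: "distributed M N X (\<lambda>q. \<integral>\<^sup>+y. ennreal (G q y) \<partial>K)"
    and G: "(\<lambda>(q, y). G q y) \<in> borel_measurable (N \<Otimes>\<^sub>M K)" and K: "sigma_finite_measure K"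
    and nonneg: "\<And>q y. 0 \<le> G q y"
  shows "has_real_density M N X (\<lambda>q. \<integral>y. G q y \<partial>K)"
proof -
  interpret K: sigma_finite_measure K by fact
  let ?g = "\<lambda>q. \<integral>\<^sup>+y. ennreal (G q y) \<partial>K"
  have G': "(\<lambda>y. G q y) \<in> borel_measurable K" if "q \<in> space N" for q
    using measurable_Pair2[OF G that] by simp
  interpret X: prob_space "density N ?g"
    using prob_space_distr[OF distributed_measurable[OF D]]
    by (simp add: distributed_distr_eq_density[OF D])
  have "(\<integral>\<^sup>+q. ?g q \<partial>N) = emeasure (density N ?g) (space N)"
    using distributed_borel_measurable[OF D]
    by (subst emeasure_density) (auto intro!: nn_integral_cong)
  also have "\<dots> = 1" using X.emeasure_space_1 by simp
  finally have "AE q in N. ?g q \<noteq> \<infinity>"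
    using distributed_borel_measurable[OF D] by (intro nn_integral_PInf_AE) auto
  then have eq: "AE q in N. ?g q = ennreal (\<integral>y. G q y \<partial>K)"
  proof (rule AE_mp, intro AE_I2 impI)
    fix q assume q: "q \<in> space N" and fin: "?g q \<noteq> \<infinity>"
    \<comment> \<open>For nonnegative \<open>G q\<close>, measurability and a finite nonnegative
      integral give integrability, so both integrals agree at this \<open>q\<close>.\<close>
    have "integrable K (G q)"
      using G'[OF q] nonneg fin by (intro integrableI_nonneg) (auto simp: top.not_eq_extremum)
    then show "?g q = ennreal (\<integral>y. G q y \<partial>K)"
      using nonneg by (intro nn_integral_eq_integral) auto
  qed
  have "(\<lambda>q. \<integral>y. G q y \<partial>K) \<in> borel_measurable N"
    by (rule K.borel_measurable_lebesgue_integral[OF G])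
  then have "distributed M N X (\<lambda>q. ennreal (\<integral>y. G q y \<partial>K))"
    using D distributed_cong_density[OF eq] distributed_borel_measurable[OF D] by auto
  then show ?thesis
    using nonneg by (simp add: has_real_density_def)
qed

theorem mainTheorem1:
  fixes M :: "'w measure" and n :: nat and \<nu> \<beta>bar :: real and \<beta> :: "nat \<Rightarrow> real"
    and Z Q :: "nat \<Rightarrow> 'w \<Rightarrow> real" and W :: "'w \<Rightarrow> real"
  assumes "prob_space M"
    and "n \<ge> 2"
    and "0 < \<nu>" and "\<nu> \<le> 1"
    and "\<And>i. i \<in> {1..n} \<Longrightarrow> 0 < \<beta> i"
    and "\<beta>bar = (\<Sum>i=1..n. \<beta> i)"
    and "prob_space.indep_vars M (\<lambda>_. borel) Z {1..n}"
    and "\<And>i. i \<in> {1..n} \<Longrightarrow> frac_gamma_distributed M (Z i) 1 (\<beta> i) \<nu>"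
    and "\<And>\<omega>. W \<omega> = (\<Sum>i=1..n. Z i \<omega>)"
    and "\<And>i \<omega>. i \<in> {1..n} \<Longrightarrow> Q i \<omega> = Z i \<omega> / W \<omega>"
  shows "has_real_density M (\<Pi>\<^sub>M i\<in>{1..n-1}. lborel) (\<lambda>\<omega>. \<lambda>i\<in>{1..n-1}. Q i \<omega>)
    (\<lambda>q. if (\<forall>i\<in>{1..n-1}. 0 < q i \<and> q i < 1) \<and> (\<Sum>i=1..n-1. q i) < 1
         then (\<Prod>i=1..n-1. q i powr (\<nu> * \<beta> i - 1))
              * (1 - (\<Sum>i=1..n-1. q i)) powr (\<nu> * \<beta> n - 1)
              * (LINT y:{0<..}|lborel.
                   y powr (\<nu> * \<beta>bar - 1)
                   * (\<Prod>i=1..n-1. mittag_leffler3 \<nu> (\<nu> * \<beta> i) (\<beta> i) (- ((y * q i) powr \<nu>)))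
                   * mittag_leffler3 \<nu> (\<nu> * \<beta> n) (\<beta> n)
                       (- ((y - y * (\<Sum>i=1..n-1. q i)) powr \<nu>)))
         else 0)"
proof -
  interpret prob_space M by fact
  define I where "I = {1..n-1}"
  have I: "finite I" "n \<notin> I" "insert n I = {1..n}" and card_I: "card I = n - 1"
    using \<open>n \<ge> 2\<close> by (auto simp: I_def)
  have \<beta>bar: "\<beta>bar = (\<Sum>i\<in>insert n I. \<beta> i)"
    unfolding I(3) by (rule assms(6))
  define f where "f i = frac_gamma_density 1 (\<beta> i) \<nu>" for i
  \<comment> \<open>Nonnegativity is the explicit first conjunct of \<open>has_real_density\<close>.
    It later lets \<open>ennreal\<close> commute with the products.\<close>
  have f_nonneg: "0 \<le> f i x" and f_distr: "distributed M lborel (Z i) (\<lambda>x. ennreal (f i x))"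
    if "i \<in> insert n I" for i x
    using assms(8)[of i] that unfolding I
    by (auto simp: frac_gamma_distributed_def has_real_density_def f_def)
  have f_meas: "f i \<in> borel_measurable borel" if "i \<in> insert n I" for i
    using distributed_real_measurable[OF _ f_distr[OF that]] f_nonneg[OF that] by simp
  have f_zero: "f i x = 0" if "x \<le> 0" for i x
    using that by (simp add: f_def frac_gamma_density_def)
  have f_pos: "f i x = x powr (\<nu> * \<beta> i - 1) * mittag_leffler3 \<nu> (\<nu> * \<beta> i) (\<beta> i) (- (x powr \<nu>))"
    if "x > 0" for i x
    using that by (simp add: f_def frac_gamma_density_def)
  \<comment> \<open>The real-valued form of the integrand in
    \<open>distributed_ratios_of_sum\<close>, with \<open>n\<close> as the distinguished
    index.\<close>
  define G where "G q y = indicator {0<..} y * y ^ card I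
      * ((\<Prod>i\<in>I. f i (y * q i)) * f n (y * (1 - (\<Sum>i\<in>I. q i))))" for q y
  have G_nonneg: "0 \<le> G q y" for q y
    using f_nonneg by (auto simp: G_def indicator_def intro!: mult_nonneg_nonneg prod_nonneg)
  have comp [measurable]: "(\<lambda>q. q i) \<in> borel_measurable (PiM I (\<lambda>_. lborel :: real measure))"
    if "i \<in> I" for i
    using measurable_component_singleton[OF that, of "\<lambda>_. lborel"] by simp
  have G_meas: "(\<lambda>(q, y). G q y) \<in> borel_measurable (PiM I (\<lambda>_. lborel) \<Otimes>\<^sub>M lborel)"
    unfolding G_def case_prod_beta'
    by (intro borel_measurable_times borel_measurable_prod measurable_compose[OF _ f_meas]) measurable
  have "distributed M (PiM I (\<lambda>_. lborel)) (\<lambda>\<omega>. \<lambda>i\<in>I. Z i \<omega> / (\<Sum>j\<in>insert n I. Z j \<omega>))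
      (\<lambda>q. \<integral>\<^sup>+y. ennreal (G q y) \<partial>lborel)"
  proof -
    have "ennreal (G q y) = indicator {0<..} y * ennreal y ^ card I
        * ((\<Prod>i\<in>I. ennreal (f i (y * q i))) * ennreal (f n (y * (1 - (\<Sum>i\<in>I. q i)))))" for q y
      using f_nonneg
      by (cases "y > 0")
        (simp_all add: G_def ennreal_mult' ennreal_mult'' prod_ennreal ennreal_power prod_nonneg)
    then show ?thesis
      using distributed_ratios_of_sum[of I n Z "\<lambda>i x. ennreal (f i x)"] I f_distr f_zero assms(7)
      by simp
  qed
  also have "(\<lambda>\<omega>. \<lambda>i\<in>I. Z i \<omega> / (\<Sum>j\<in>insert n I. Z j \<omega>)) = (\<lambda>\<omega>. \<lambda>i\<in>I. Q i \<omega>)"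
    unfolding I(3) using assms(9,10) by (auto simp: I_def fun_eq_iff)
  finally have density: "has_real_density M (PiM I (\<lambda>_. lborel)) (\<lambda>\<omega>. \<lambda>i\<in>I. Q i \<omega>)
      (\<lambda>q. \<integral>y. G q y \<partial>lborel)"
    by (intro has_real_density_lebesgue_integral G_meas G_nonneg lborel.sigma_finite_measure_axioms)
      (simp add: restrict_def)
  \<comment> \<open>This identity holds at every \<open>q\<close>, not merely almost everywhere: on
    the simplex the integrands agree, and off it \<open>G q\<close> is identically 0.\<close>
  have formula: "(if (\<forall>i\<in>I. 0 < q i \<and> q i < 1) \<and> (\<Sum>i\<in>I. q i) < 1
         then (\<Prod>i\<in>I. q i powr (\<nu> * \<beta> i - 1))
              * (1 - (\<Sum>i\<in>I. q i)) powr (\<nu> * \<beta> n - 1)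
              * (LINT y:{0<..}|lborel.
                   y powr (\<nu> * \<beta>bar - 1)
                   * (\<Prod>i\<in>I. mittag_leffler3 \<nu> (\<nu> * \<beta> i) (\<beta> i) (- ((y * q i) powr \<nu>)))
                   * mittag_leffler3 \<nu> (\<nu> * \<beta> n) (\<beta> n)
                       (- ((y - y * (\<Sum>i\<in>I. q i)) powr \<nu>)))
         else 0) = (\<integral>y. G q y \<partial>lborel)" (is "(if ?simplex then ?c * (LINT y:_|_. ?b y) else 0) = _") for q
  proof (cases ?simplex)
    case True
    let ?s = "1 - (\<Sum>i\<in>I. q i)"
    have "?c * (indicator {0<..} y * ?b y) = G q y" for y
    proof (cases "y > 0")
      case y: True
      \<comment> \<open>The \<open>n\<close> densities contribute \<open>n\<close> terms -1 to the
        exponent of \<open>y\<close>; the scaling factor restores \<open>n - 1\<close> of them, so a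
        single -1 remains.\<close>
      have expo: "(\<Sum>i\<in>I. \<nu> * \<beta> i - 1) + (\<nu> * \<beta> n - 1) + real (card I) = \<nu> * \<beta>bar - 1"
        using I(1,2) by (simp add: \<beta>bar sum_subtractf sum_distrib_left algebra_simps)
      have "y powr (\<nu> * \<beta>bar - 1)
          = y ^ card I * (\<Prod>i\<in>I. y powr (\<nu> * \<beta> i - 1)) * y powr (\<nu> * \<beta> n - 1)"
        unfolding expo[symmetric] using y I(1) by (simp add: powr_add powr_sum powr_realpow mult_ac)
      moreover have "y - y * (\<Sum>i\<in>I. q i) = y * ?s" by (simp add: algebra_simps)
      moreover have "f n (y * ?s) = y powr (\<nu> * \<beta> n - 1) * ?s powr (\<nu> * \<beta> n - 1)
          * mittag_leffler3 \<nu> (\<nu> * \<beta> n) (\<beta> n) (- ((y * ?s) powr \<nu>))"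
        \<comment> \<open>The simplex condition makes \<open>?s\<close> positive, so the argument of
          \<open>f n\<close> is positive and its power splits.\<close>
        using y True by (simp add: f_pos powr_mult)
      moreover have "(\<Prod>i\<in>I. f i (y * q i)) = (\<Prod>i\<in>I. y powr (\<nu> * \<beta> i - 1))
          * (\<Prod>i\<in>I. q i powr (\<nu> * \<beta> i - 1))
          * (\<Prod>i\<in>I. mittag_leffler3 \<nu> (\<nu> * \<beta> i) (\<beta> i) (- ((y * q i) powr \<nu>)))"
        using y True by (simp add: f_pos powr_mult prod.distrib[symmetric])
      ultimately show ?thesis
        using y by (simp add: G_def mult_ac)
    qed (simp add: G_def)
    \<comment> \<open>The factor \<open>?c\<close> does not depend on \<open>y\<close>. Taking it
      out of the Bochner integral is sound even under divergence, since both sides are then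
      0.\<close>
    then have "(\<integral>y. ?c * (indicator {0<..} y * ?b y) \<partial>lborel) = (\<integral>y. G q y \<partial>lborel)" by simp
    then show ?thesis
      using True by (simp add: set_lebesgue_integral_def)
  next
    case False
    have "G q y = 0" for y
    proof (cases "y > 0")
      case y: True
      show ?thesis
      proof (cases "\<exists>i\<in>I. q i \<le> 0")
        case True
        then have "\<exists>i\<in>I. f i (y * q i) = 0"
          using y by (auto intro!: f_zero simp: mult_le_0_iff)
        then show ?thesis using I(1) by (simp add: G_def prod_zero_iff)
      next
        case pos: False
        \<comment> \<open>All \<open>q i\<close> are positive here. Were their sum below 1, each of
          them, being at most the sum, would be below 1 too, and \<open>q\<close> would lie in the
          simplex. A sum of at least 1 makes the argument of \<open>f n\<close> nonpositive.\<close>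
        have "(\<Sum>i\<in>I. q i) \<ge> 1"
        proof (rule ccontr)
          assume "\<not> (\<Sum>i\<in>I. q i) \<ge> 1"
          moreover have "q i \<le> (\<Sum>i\<in>I. q i)" if "i \<in> I" for i
            using that pos I(1) by (intro member_le_sum) force+
          ultimately show False using False pos by force
        qed
        then have "f n (y * (1 - (\<Sum>i\<in>I. q i))) = 0"
          using y by (intro f_zero) (simp add: mult_le_0_iff)
        then show ?thesis by (simp add: G_def)
      qed
    qed (simp add: G_def)
    then show ?thesis using False by auto
  qed
  show ?thesis
    using density unfolding formula[symmetric] unfolding I_def .
qed

end
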